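(* Let $\mathcal{L}$ be a finite join-semidistributive lattice with at least two atoms and at least two coatoms, let $\mathcal{M}$ be a maximal sublattice of $\mathcal{L}$, and let $a$ be a coatom of $\mathcal{L}$. If $a\in\mathcal{C}=\mathcal{L}\setminus\mathcal{M}$, then $\mathcal{C}$ is an interval of $\mathcal{L}$.
   Context: A lattice is join-semidistributive if $x\vee y=x\vee z$ implies $x\vee(y\wedge z)=x\vee y$ for all $x,y,z$. A maximal sublattice is a proper (nonempty) sublattice not contained in any other proper sublattice. An interval is a set of the form $[a,b]=\{c: a\le c\le b\}$. Atoms are the covers of the least element, coatoms the subcovers of the greatest element. *)

theory Defs
  imports Main
begin

definition join_semidistributive :: "'a::lattice itself \<Rightarrow> bool" where
  "join_semidistributive _ \<longleftrightarrow>
     (\<forall>x y z :: 'a. sup x y = sup x z \<longrightarrow> sup x (inf y z) = sup x y)"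

definition covers :: "'a::order \<Rightarrow> 'a \<Rightarrow> bool" where
  "covers y x \<longleftrightarrow> x < y \<and> \<not> (\<exists>z. x < z \<and> z < y)"

definition atoms :: "'a::bounded_lattice set" where
  "atoms = {x. covers x bot}"

definition coatoms :: "'a::bounded_lattice set" where
  "coatoms = {x. covers top x}"

text \<open>Sublattices need not contain the bounds of the ambient lattice.\<close>

definition sublattice :: "'a::lattice set \<Rightarrow> bool" where
  "sublattice S \<longleftrightarrow> S \<noteq> {} \<and> (\<forall>x\<in>S. \<forall>y\<in>S. sup x y \<in> S \<and> inf x y \<in> S)"

definition maximal_sublattice :: "'a::lattice set \<Rightarrow> bool" where
  "maximal_sublattice M \<longleftrightarrow>
     sublattice M \<and> M \<noteq> UNIV \<and>
     \<not> (\<exists>S. sublattice S \<and> S \<noteq> UNIV \<and> S \<noteq> M \<and> M \<subseteq> S)"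

definition is_interval :: "'a::order set \<Rightarrow> bool" where
  "is_interval C \<longleftrightarrow> (\<exists>a b. a \<le> b \<and> C = {a..b})"

end

(* Join semidistributivity makes the elements below q but not below a lower cover p of q closed
   under meets, so they have a least element. Applied to the coatom a below top, this gives b with
   the whole lattice the disjoint union of {..a} and {b..}. If p is the largest element of M below
   a, then M is contained in the proper sublattice {..p} \<union> {b..}, so maximality gives equality and
   forces a to cover p. The complement is thus {..a} - {..p}, and a second application of the first
   remark exhibits its least element. *)
theory Submission
  imports Defs
begin

lemma finite_inf_closed_has_least:
  fixes S :: "'a::lattice set"
  assumes "finite S" "S \<noteq> {}" "\<And>x y. x \<in> S \<Longrightarrow> y \<in> S \<Longrightarrow> inf x y \<in> S"
  shows "\<exists>c\<in>S. \<forall>x\<in>S. c \<le> x"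
proof -
  obtain c where c: "c \<in> S" "\<And>x. x \<in> S \<Longrightarrow> x \<le> c \<Longrightarrow> c = x"
    using finite_has_minimal[OF assms(1,2)] by blast
  have "c \<le> x" if "x \<in> S" for x
    using c(2)[OF assms(3)[OF c(1) that]] by (metis inf.cobounded1 inf.cobounded2)
  with c(1) show ?thesis by blast
qed

lemma finite_sup_closed_has_greatest:
  fixes S :: "'a::lattice set"
  assumes "finite S" "S \<noteq> {}" "\<And>x y. x \<in> S \<Longrightarrow> y \<in> S \<Longrightarrow> sup x y \<in> S"
  shows "\<exists>c\<in>S. \<forall>x\<in>S. x \<le> c"
proof -
  obtain c where c: "c \<in> S" "\<And>x. x \<in> S \<Longrightarrow> c \<le> x \<Longrightarrow> c = x"
    using finite_has_maximal[OF assms(1,2)] by blast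
  have "x \<le> c" if "x \<in> S" for x
    using c(2)[OF assms(3)[OF c(1) that]] by (metis sup.cobounded1 sup.cobounded2)
  with c(1) show ?thesis by blast
qed

lemma sup_eq_if_covers:
  fixes p q x :: "'a::lattice"
  assumes "covers q p" "x \<le> q" "\<not> x \<le> p"
  shows "sup p x = q"
proof -
  have "p < sup p x" "sup p x \<le> q"
    using assms by (auto simp: covers_def less_le intro: sup.cobounded1)
      (metis sup.cobounded2)
  with assms(1) show ?thesis
    unfolding covers_def by (metis order.not_eq_order_implies_strict)
qed

text \<open>Since \<open>q\<close> covers \<open>p\<close>, any \<open>x \<le> q\<close> not below
  \<open>p\<close> satisfies \<open>sup p x = q\<close>. Join semidistributivity then gives
  \<open>sup p (inf x y) = q\<close> for two such elements, so \<open>inf x y\<close> is not below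
  \<open>p\<close> either, and finiteness yields a least one.\<close>

lemma join_semidistributive_covers_least:
  fixes p q :: "'a::{finite,lattice}"
  assumes jsd: "join_semidistributive TYPE('a)" and cov: "covers q p"
  shows "\<exists>c\<le>q. \<forall>x\<le>q. \<not> x \<le> p \<longleftrightarrow> c \<le> x"
proof -
  let ?S = "{x. x \<le> q \<and> \<not> x \<le> p}"
  have "inf x y \<in> ?S" if "x \<in> ?S" "y \<in> ?S" for x y
  proof -
    have "sup p x = q" "sup p y = q"
      using that sup_eq_if_covers[OF cov] by auto
    then have "sup p (inf x y) = q"
      using jsd unfolding join_semidistributive_def by metis
    moreover have "q \<noteq> p"
      using cov by (auto simp: covers_def)
    ultimately show ?thesis
      using that by (auto simp: sup.absorb_iff1 intro: le_infI1)
  qed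
  moreover have "q \<in> ?S"
    using cov by (auto simp: covers_def)
  ultimately obtain c where "c \<in> ?S" "\<forall>x\<in>?S. c \<le> x"
    using finite_inf_closed_has_least[of ?S] by auto
  then have "\<not> x \<le> p \<longleftrightarrow> c \<le> x" if "x \<le> q" for x
    using that by (auto dest: order_trans)
  with \<open>c \<in> ?S\<close> show ?thesis by blast
qed

text \<open>In a mixed pair the join stays above \<open>b\<close> and the meet stays below
  \<open>p\<close>.\<close>

lemma sublattice_atMost_Un_atLeast:
  fixes p b :: "'a::lattice"
  shows "sublattice ({..p} \<union> {b..})"
  by (auto simp: sublattice_def intro: le_infI1 le_infI2 le_supI1 le_supI2)

lemma maximal_sublattice_eqI:
  assumes "maximal_sublattice M" "sublattice S" "M \<subseteq> S" "x \<notin> S"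
  shows "S = M"
  using assms unfolding maximal_sublattice_def by blast

text \<open>Adjoining \<open>bot\<close> keeps a sublattice closed, and the result still misses
  \<open>a\<close>.\<close>

lemma bot_in_maximal_sublattice:
  fixes M :: "'a::bounded_lattice set"
  assumes max: "maximal_sublattice M" and a: "a \<notin> M" "a \<noteq> bot"
  shows "bot \<in> M"
proof -
  have "sublattice (insert bot M)"
    using max by (auto simp: maximal_sublattice_def sublattice_def)
  then have "insert bot M = M"
    using maximal_sublattice_eqI[OF max] a by blast
  then show ?thesis by blast
qed

text \<open>If \<open>bot\<close> were a coatom, any other coatom would lie strictly between
  \<open>bot\<close> and \<open>top\<close>.\<close>

lemma coatom_not_bot:
  fixes a :: "'a::bounded_lattice"
  assumes "a \<in> coatoms" "card (coatoms :: 'a set) \<ge> 2"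
  shows "a \<noteq> bot"
proof
  assume "a = bot"
  then have "x = a" if "x \<in> coatoms" for x
    using assms(1) that bot.not_eq_extremum[of x] by (auto simp: coatoms_def covers_def)
  then have "coatoms = {a}"
    using assms(1) by blast
  then have "card (coatoms :: 'a set) = card {a}" by (rule arg_cong)
  with assms(2) show False by simp
qed

theorem corollary4p6:
  fixes M :: "'a::{finite,bounded_lattice} set" and a :: 'a
  assumes "join_semidistributive TYPE('a)"
    and "card (atoms :: 'a set) \<ge> 2"
    and "card (coatoms :: 'a set) \<ge> 2"
    and "maximal_sublattice M"
    and "a \<in> coatoms"
    and "a \<in> - M"
  shows "is_interval (- M)"
proof -
  have bot: "bot \<in> M"
    using bot_in_maximal_sublattice coatom_not_bot assms by blast
  have sub: "sublattice M"
    using assms(4) by (simp add: maximal_sublattice_def)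
  have "covers top a"
    using assms(5) by (simp add: coatoms_def)
  then obtain b where b: "\<And>x. \<not> x \<le> a \<longleftrightarrow> b \<le> x"
    using join_semidistributive_covers_least[OF assms(1)] by (metis top_greatest)
  \<comment> \<open>Here \<open>bot\<close> guarantees that the intersection is nonempty.\<close>
  have "\<exists>p\<in>M \<inter> {..a}. \<forall>x\<in>M \<inter> {..a}. x \<le> p"
    using bot sub by (intro finite_sup_closed_has_greatest) (auto simp: sublattice_def)
  then obtain p where p: "p \<in> M" "p \<le> a" "\<And>x. x \<in> M \<Longrightarrow> x \<le> a \<Longrightarrow> x \<le> p"
    by auto
  have "p < a"
    using p assms(6) by (auto simp: less_le)
  have M_subset: "M \<subseteq> {..r} \<union> {b..}" if "p \<le> r" for r
    using p(3) b order_trans[OF _ that] by blast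
  \<comment> \<open>The union is proper because it misses \<open>a\<close>: \<open>r < a\<close>,
    and \<open>b \<le> a\<close> would contradict \<open>a \<le> a\<close>. A general
    \<open>r\<close> serves twice: strictly between \<open>p\<close> and \<open>a\<close> to prove
    the covering, and \<open>r = p\<close> to describe \<open>M\<close>.\<close>
  have eq_M: "{..r} \<union> {b..} = M" if "p \<le> r" "r < a" for r
    by (rule maximal_sublattice_eqI[OF assms(4) sublattice_atMost_Un_atLeast M_subset, of _ a])
      (use that b[of a] in auto)
  have "covers a p"
    unfolding covers_def
  proof (intro conjI notI)
    assume "\<exists>r. p < r \<and> r < a"
    then obtain r where r: "p < r" "r < a" by blast
    then have "r \<in> M" using eq_M[of r] by (auto simp: less_imp_le)
    with r p(3)[of r] show False by (auto simp: less_le_not_le)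
  qed fact
  then obtain c where c: "c \<le> a" "\<And>x. x \<le> a \<Longrightarrow> \<not> x \<le> p \<longleftrightarrow> c \<le> x"
    using join_semidistributive_covers_least[OF assms(1)] by blast
  \<comment> \<open>Outside \<open>M\<close> means neither \<open>x \<le> p\<close> nor
    \<open>b \<le> x\<close>; the latter failing is \<open>x \<le> a\<close>, under which the former
    failing is \<open>c \<le> x\<close>.\<close>
  have "x \<in> - M \<longleftrightarrow> x \<in> {c..a}" for x
    using eq_M[OF order_refl \<open>p < a\<close>] b[of x] c(2)[of x] by auto
  then have "- M = {c..a}" by blast
  with c(1) show ?thesis
    unfolding is_interval_def by blast
qed

end
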